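(* Let $(X,d)$ be an externally convex metric space. If $d$ is a round metric for $X$, then $d$ is a sleek metric for $X$.
   Context: For $x\in X$ and $r>0$, write $B_d(x,r)=\{z\in X: d(x,z)<r\}$ and $B_d[x,r]=\{z\in X: d(x,z)\le r\}$. The metric $d$ is a round metric for $X$ if the closure of $B_d(x,r)$ equals $B_d[x,r]$ for all $x\in X$ and $r>0$; it is a sleek metric for $X$ if the interior of $B_d[x,r]$ equals $B_d(x,r)$ for all $x\in X$ and $r>0$. A metric space $(X,d)$ is externally convex if for every pair of distinct points $x,y\in X$ there exists $z\in X\setminus\{x,y\}$ with $d(x,y)+d(y,z)=d(x,z)$. *)

theory Defs
  imports "HOL-Analysis.Abstract_Metric_Spaces"
begin

context Metric_space
begin

definition round_metric :: bool where
  "round_metric \<longleftrightarrow> (\<forall>x\<in>M. \<forall>r>0. mtopology closure_of (mball x r) = mcball x r)"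

definition sleek_metric :: bool where
  "sleek_metric \<longleftrightarrow> (\<forall>x\<in>M. \<forall>r>0. mtopology interior_of (mcball x r) = mball x r)"

definition externally_convex :: bool where
  "externally_convex \<longleftrightarrow>
    (\<forall>x\<in>M. \<forall>y\<in>M. x \<noteq> y \<longrightarrow> (\<exists>z\<in>M - {x, y}. d x y + d y z = d x z))"

end

end

theory Submission
  imports Defs
begin

text \<open>
  Let \<open>d x y = r > 0\<close>. External convexity prolongs the segment from \<open>x\<close> to \<open>y\<close> up to a point \<open>z\<close>,
  so that \<open>d x z = r + s\<close> with \<open>s = d y z > 0\<close>. The open ball of radius \<open>s\<close> about \<open>z\<close> is then
  disjoint from the closed ball of radius \<open>r\<close> about \<open>x\<close>, by the triangle inequality, while
  roundness places \<open>y\<close> in its closure. Hence every neighbourhood of \<open>y\<close> leaves the closed ball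
  about \<open>x\<close>: no point of the sphere is interior to the closed ball.
\<close>

context Metric_space
begin

text \<open>
  The ball about \<open>z\<close> that touches \<open>y\<close> from the far side supplies points arbitrarily near \<open>y\<close>
  and farther from \<open>x\<close> than \<open>y\<close> is.
\<close>

lemma sphere_not_in_interior_of_mcball:
  assumes ext: "externally_convex" and round: "round_metric"
    and x: "x \<in> M" and y: "y \<in> M" and "x \<noteq> y"
  shows "y \<notin> mtopology interior_of (mcball x (d x y))"
proof
  assume "y \<in> mtopology interior_of (mcball x (d x y))"
  then obtain T where T: "openin mtopology T" "y \<in> T" "T \<subseteq> mcball x (d x y)"
    by (auto simp: interior_of_def)
  obtain z where z: "z \<in> M" "z \<noteq> y" and between: "d x y + d y z = d x z"
    using ext x y \<open>x \<noteq> y\<close> unfolding externally_convex_def by blast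
  have "0 < d z y"
    using z y by simp
  then have "mtopology closure_of (mball z (d z y)) = mcball z (d z y)"
    using round z unfolding round_metric_def by blast
  then have "y \<in> mtopology closure_of (mball z (d z y))"
    using z y by simp
  then obtain w where w: "w \<in> T" "w \<in> mball z (d z y)"
    using T by (auto simp: in_closure_of)
  have "d x w \<le> d x y"
    using w T by auto
  moreover have "d x z \<le> d x w + d w z"
    using triangle x z w by auto
  moreover have "d w z < d y z"
    using w by (simp add: commute)
  ultimately show False
    using between by linarith
qed

end

theorem theorem3p10:
  fixes X :: "'a set" and d :: "'a \<Rightarrow> 'a \<Rightarrow> real"
  assumes "Metric_space X d"
    and "Metric_space.externally_convex X d"
    and "Metric_space.round_metric X d"
  shows "Metric_space.sleek_metric X d"
proof -
  interpret Metric_space X d by (rule assms(1))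
  show ?thesis
    unfolding sleek_metric_def
  proof (intro ballI allI impI equalityI)
    fix x and r :: real
    assume x: "x \<in> X" and "0 < r"
    show "mball x r \<subseteq> mtopology interior_of (mcball x r)"
      by (simp add: interior_of_maximal mball_subset_mcball)
    show "mtopology interior_of (mcball x r) \<subseteq> mball x r"
    proof
      fix y assume y: "y \<in> mtopology interior_of (mcball x r)"
      then have "y \<in> mcball x r"
        using interior_of_subset by fastforce
      then have "y \<in> X" "d x y \<le> r" by auto
      have "d x y \<noteq> r"
      proof
        assume "d x y = r"
        then have "x \<noteq> y"
          using x \<open>0 < r\<close> by auto
        then show False
          using sphere_not_in_interior_of_mcball[OF assms(2,3) x \<open>y \<in> X\<close>] y
            \<open>d x y = r\<close> by simp
      qed
      then show "y \<in> mball x r"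
        using x \<open>y \<in> X\<close> \<open>d x y \<le> r\<close> by simp
    qed
  qed
qed

end
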